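(* The calculus PC is sound with respect to $\vDash_{PC}$: every formula of $\mathcal{L}_{PC}$ derivable in PC is true at every world of every conditional neighbourhood model under $\vDash_{PC}$.
   Context: Fix a set $P$ of proposition letters and a finite set $Ag$ of agents. The language $\mathcal{L}_{PC}$ is $\phi::=\top\mid p\mid\neg\phi\mid(\phi\wedge\phi)\mid B_a(\phi,\phi)\mid[\phi]\phi$ ($p\in P$, $a\in Ag$); $\bot,\vee,\to,\leftrightarrow$ as usual, $K_a\phi:=\neg B_a(\neg\phi,\top)$, $\check K_a\phi:=\neg K_a\neg\phi$. A conditional neighbourhood model is $\mathfrak{M}=(W,N,V)$: $W$ non-empty, $V:P\to\mathcal{P}(W)$, and $N$ assigns to each $a\in Ag$, $w\in W$, $X\subseteq W$ a set $N_a^w(X)\subseteq\mathcal{P}(W)$ such that, writing $[w]_a=\{v\mid\forall X\subseteq W,\ N_a^w(X)=N_a^v(X)\}$: (c) each $Y\in N_a^w(X)$ has $Y\subseteq X\cap[w]_a$; (ec) if $X\cap[w]_a=Y\cap[w]_a$ then $N_a^w(X)=N_a^w(Y)$; (d) for $Y\in N_a^w(X)$, $(X\cap[w]_a)\setminus Y\notin N_a^w(X)$; (sc) for $Y,Z\subseteq X\cap[w]_a$, if $(X\cap[w]_a)\setminus Y\notin N_a^w(X)$ and $Y\subsetneq Z$ then $Z\in N_a^w(X)$. Semantics $\vDash_{PC}$: $\top$ always true; $p$ iff $w\in V(p)$; Booleans as usual; $\mathfrak{M},w\vDash B_a(\phi,\psi)$ iff some $Y\in N_a^w(\llbracket\phi\rrbracket_{\mathfrak{M}})$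 has $Y\subseteq\llbracket\psi\rrbracket_{\mathfrak{M}}$ (where $\llbracket\phi\rrbracket_{\mathfrak{M}}=\{v\mid\mathfrak{M},v\vDash\phi\}$); $\mathfrak{M},w\vDash[\phi]\psi$ iff ($\mathfrak{M},w\vDash\phi$ implies $\mathfrak{M}^\phi,w\vDash\psi$). Here the update $\mathfrak{M}^\phi=(W^\phi,{}^\phi N,V^\phi)$ has $W^\phi=\llbracket\phi\rrbracket_{\mathfrak{M}}$, ${}^\phi N_a^w(X)=N_a^w(X)$ for $w\in W^\phi$ and $X\subseteq W^\phi$, and $V^\phi(p)=V(p)\cap W^\phi$ (its induced indistinguishability classes are $[w]_a\cap W^\phi$). The calculus PC consists of the CN calculus over $\mathcal{L}_{PC}$ — axioms (Taut) propositional tautologies; (Dist-K) $K_a(\phi\to\psi)\to K_a\phi\to K_a\psi$; (T) $K_a\phi\to\phi$; (5B) $B_a(\phi,\psi)\to K_aB_a(\phi,\psi)$; (4B) $\neg B_a(\phi,\psi)\to K_a\neg B_a(\phi,\psi)$; (D) $B_a(\phi,\psi)\to\neg B_a(\phi,\neg\psi)$; (EC) $K_a(\phi\leftrightarrow\psi)\to B_a(\phi,\chi)\to B_a(\psi,\chi)$; (M) $K_a(\phi\to\psi)\to B_a(\chi,\phi)\to B_a(\chi,\psi)$; (C) $B_a(\phi,\psi)\to B_a(\phi,\phi\wedge\psi)$; (SC) $\neg B_a(\chi,\neg\phi)\wedge\check K_a(\chi\wedge\neg\phi\wedge\psi)\to B_a(\chi,\phi\vee\psi)$; rules Modus Ponens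 and from $\phi$ infer $K_a\phi$ — plus the usual reduction axioms for public announcement: $[\phi]\top\leftrightarrow\top$, $[\phi]p\leftrightarrow(\phi\to p)$, $[\phi]\neg\psi\leftrightarrow(\phi\to\neg[\phi]\psi)$, $[\phi](\psi\wedge\chi)\leftrightarrow([\phi]\psi\wedge[\phi]\chi)$, and $[\phi]B_a(\psi,\chi)\leftrightarrow(\phi\to B_a(\phi\wedge[\phi]\psi,[\phi]\chi))$. *)

theory Defs
  imports Main
begin

text \<open>Formulas over proposition letters \<open>'p\<close> and agents \<open>'a\<close>:
  \<open>Bel a \<phi> \<psi>\<close> is $B_a(\phi,\psi)$, belief in \<open>\<psi>\<close> conditional on \<open>\<phi>\<close>,
  \<open>Ann \<phi> \<psi>\<close> is $[\phi]\psi$.\<close>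

datatype ('p, 'a) fm =
    Top
  | Atom 'p
  | Neg "('p, 'a) fm"  (\<open>\<^bold>\<not> _\<close> [80] 80)
  | Con "('p, 'a) fm" "('p, 'a) fm"  (infixr \<open>\<^bold>\<and>\<close> 75)
  | Bel 'a "('p, 'a) fm" "('p, 'a) fm"
  | Ann "('p, 'a) fm" "('p, 'a) fm"

abbreviation Dis :: "('p, 'a) fm \<Rightarrow> ('p, 'a) fm \<Rightarrow> ('p, 'a) fm"  (infixr \<open>\<^bold>\<or>\<close> 70)
  where "\<phi> \<^bold>\<or> \<psi> \<equiv> \<^bold>\<not> (\<^bold>\<not> \<phi> \<^bold>\<and> \<^bold>\<not> \<psi>)"

abbreviation Imp :: "('p, 'a) fm \<Rightarrow> ('p, 'a) fm \<Rightarrow> ('p, 'a) fm"  (infixr \<open>\<^bold>\<longrightarrow>\<close> 65)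
  where "\<phi> \<^bold>\<longrightarrow> \<psi> \<equiv> \<^bold>\<not> (\<phi> \<^bold>\<and> \<^bold>\<not> \<psi>)"

abbreviation Iff :: "('p, 'a) fm \<Rightarrow> ('p, 'a) fm \<Rightarrow> ('p, 'a) fm"  (infix \<open>\<^bold>\<longleftrightarrow>\<close> 60)
  where "\<phi> \<^bold>\<longleftrightarrow> \<psi> \<equiv> (\<phi> \<^bold>\<longrightarrow> \<psi>) \<^bold>\<and> (\<psi> \<^bold>\<longrightarrow> \<phi>)"

abbreviation Know :: "'a \<Rightarrow> ('p, 'a) fm \<Rightarrow> ('p, 'a) fm"
  where "Know a \<phi> \<equiv> \<^bold>\<not> Bel a (\<^bold>\<not> \<phi>) Top"

abbreviation Poss :: "'a \<Rightarrow> ('p, 'a) fm \<Rightarrow> ('p, 'a) fm"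
  where "Poss a \<phi> \<equiv> \<^bold>\<not> Know a (\<^bold>\<not> \<phi>)"

text \<open>Only the values \<open>nbh M a w X\<close> with \<open>w \<in> worlds M\<close> and \<open>X \<subseteq> worlds M\<close> are
  meaningful; the conditions on models and truth at a world of \<open>worlds M\<close> depend on no others.\<close>

record ('p, 'a, 'w) cn_struct =
  worlds :: "'w set"
  nbh :: "'a \<Rightarrow> 'w \<Rightarrow> 'w set \<Rightarrow> 'w set set"
  val :: "'p \<Rightarrow> 'w set"

definition cell :: "('p, 'a, 'w) cn_struct \<Rightarrow> 'a \<Rightarrow> 'w \<Rightarrow> 'w set" where
  "cell M a w = {v \<in> worlds M. \<forall>X \<subseteq> worlds M. nbh M a w X = nbh M a v X}"

definition cn_model :: "('p, 'a, 'w) cn_struct \<Rightarrow> bool" where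
  "cn_model M \<longleftrightarrow>
     worlds M \<noteq> {} \<and>
     (\<forall>p. val M p \<subseteq> worlds M) \<and>
     (\<forall>a. \<forall>w \<in> worlds M. \<forall>X \<subseteq> worlds M. nbh M a w X \<subseteq> Pow (worlds M)) \<and>
     \<comment> \<open>(c)\<close>
     (\<forall>a. \<forall>w \<in> worlds M. \<forall>X \<subseteq> worlds M. \<forall>Y \<in> nbh M a w X. Y \<subseteq> X \<inter> cell M a w) \<and>
     \<comment> \<open>(ec)\<close>
     (\<forall>a. \<forall>w \<in> worlds M. \<forall>X \<subseteq> worlds M. \<forall>Y \<subseteq> worlds M.
        X \<inter> cell M a w = Y \<inter> cell M a w \<longrightarrow> nbh M a w X = nbh M a w Y) \<and>
     \<comment> \<open>(d)\<close>
     (\<forall>a. \<forall>w \<in> worlds M. \<forall>X \<subseteq> worlds M. \<forall>Y \<in> nbh M a w X.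
        (X \<inter> cell M a w) - Y \<notin> nbh M a w X) \<and>
     \<comment> \<open>(sc)\<close>
     (\<forall>a. \<forall>w \<in> worlds M. \<forall>X \<subseteq> worlds M.
        \<forall>Y \<subseteq> X \<inter> cell M a w. \<forall>Z \<subseteq> X \<inter> cell M a w.
          (X \<inter> cell M a w) - Y \<notin> nbh M a w X \<and> Y \<subset> Z \<longrightarrow> Z \<in> nbh M a w X)"

definition restrict_model ::
  "('p, 'a, 'w) cn_struct \<Rightarrow> 'w set \<Rightarrow> ('p, 'a, 'w) cn_struct" where
  "restrict_model M U = \<lparr>worlds = U, nbh = nbh M, val = (\<lambda>p. val M p \<inter> U)\<rparr>"

primrec sat :: "('p, 'a, 'w) cn_struct \<Rightarrow> 'w \<Rightarrow> ('p, 'a) fm \<Rightarrow> bool" where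
  "sat M w Top \<longleftrightarrow> True"
| "sat M w (Atom p) \<longleftrightarrow> w \<in> val M p"
| "sat M w (\<^bold>\<not> \<phi>) \<longleftrightarrow> \<not> sat M w \<phi>"
| "sat M w (\<phi> \<^bold>\<and> \<psi>) \<longleftrightarrow> sat M w \<phi> \<and> sat M w \<psi>"
| "sat M w (Bel a \<phi> \<psi>) \<longleftrightarrow>
     (\<exists>Y \<in> nbh M a w {v \<in> worlds M. sat M v \<phi>}. Y \<subseteq> {v \<in> worlds M. sat M v \<psi>})"
| "sat M w (Ann \<phi> \<psi>) \<longleftrightarrow>
     (sat M w \<phi> \<longrightarrow> sat (restrict_model M {v \<in> worlds M. sat M v \<phi>}) w \<psi>)"

text \<open>A formula counts as a propositional tautology if it is true under every truth
  assignment to its maximal subformulas whose main operator is not Boolean.\<close>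

primrec bool_eval :: "(('p, 'a) fm \<Rightarrow> bool) \<Rightarrow> ('p, 'a) fm \<Rightarrow> bool" where
  "bool_eval g Top \<longleftrightarrow> True"
| "bool_eval g (Atom p) \<longleftrightarrow> g (Atom p)"
| "bool_eval g (\<^bold>\<not> \<phi>) \<longleftrightarrow> \<not> bool_eval g \<phi>"
| "bool_eval g (\<phi> \<^bold>\<and> \<psi>) \<longleftrightarrow> bool_eval g \<phi> \<and> bool_eval g \<psi>"
| "bool_eval g (Bel a \<phi> \<psi>) \<longleftrightarrow> g (Bel a \<phi> \<psi>)"
| "bool_eval g (Ann \<phi> \<psi>) \<longleftrightarrow> g (Ann \<phi> \<psi>)"

definition tautology :: "('p, 'a) fm \<Rightarrow> bool" where
  "tautology \<phi> \<longleftrightarrow> (\<forall>g. bool_eval g \<phi>)"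

inductive PC :: "('p, 'a) fm \<Rightarrow> bool" where
  Taut: "tautology \<phi> \<Longrightarrow> PC \<phi>"
| DistK: "PC (Know a (\<phi> \<^bold>\<longrightarrow> \<psi>) \<^bold>\<longrightarrow> Know a \<phi> \<^bold>\<longrightarrow> Know a \<psi>)"
| T: "PC (Know a \<phi> \<^bold>\<longrightarrow> \<phi>)"
| B5: "PC (Bel a \<phi> \<psi> \<^bold>\<longrightarrow> Know a (Bel a \<phi> \<psi>))"
| B4: "PC (\<^bold>\<not> Bel a \<phi> \<psi> \<^bold>\<longrightarrow> Know a (\<^bold>\<not> Bel a \<phi> \<psi>))"
| D: "PC (Bel a \<phi> \<psi> \<^bold>\<longrightarrow> \<^bold>\<not> Bel a \<phi> (\<^bold>\<not> \<psi>))"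
| EC: "PC (Know a (\<phi> \<^bold>\<longleftrightarrow> \<psi>) \<^bold>\<longrightarrow> Bel a \<phi> \<chi> \<^bold>\<longrightarrow> Bel a \<psi> \<chi>)"
| M: "PC (Know a (\<phi> \<^bold>\<longrightarrow> \<psi>) \<^bold>\<longrightarrow> Bel a \<chi> \<phi> \<^bold>\<longrightarrow> Bel a \<chi> \<psi>)"
| C: "PC (Bel a \<phi> \<psi> \<^bold>\<longrightarrow> Bel a \<phi> (\<phi> \<^bold>\<and> \<psi>))"
| SC: "PC (\<^bold>\<not> Bel a \<chi> (\<^bold>\<not> \<phi>) \<^bold>\<and> Poss a (\<chi> \<^bold>\<and> \<^bold>\<not> \<phi> \<^bold>\<and> \<psi>) \<^bold>\<longrightarrow> Bel a \<chi> (\<phi> \<^bold>\<or> \<psi>))"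
| MP: "PC (\<phi> \<^bold>\<longrightarrow> \<psi>) \<Longrightarrow> PC \<phi> \<Longrightarrow> PC \<psi>"
| NecK: "PC \<phi> \<Longrightarrow> PC (Know a \<phi>)"
| AnnTop: "PC (Ann \<phi> Top \<^bold>\<longleftrightarrow> Top)"
| AnnAtom: "PC (Ann \<phi> (Atom p) \<^bold>\<longleftrightarrow> (\<phi> \<^bold>\<longrightarrow> Atom p))"
| AnnNeg: "PC (Ann \<phi> (\<^bold>\<not> \<psi>) \<^bold>\<longleftrightarrow> (\<phi> \<^bold>\<longrightarrow> \<^bold>\<not> Ann \<phi> \<psi>))"
| AnnCon: "PC (Ann \<phi> (\<psi> \<^bold>\<and> \<chi>) \<^bold>\<longleftrightarrow> (Ann \<phi> \<psi> \<^bold>\<and> Ann \<phi> \<chi>))"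
| AnnBel: "PC (Ann \<phi> (Bel a \<psi> \<chi>) \<^bold>\<longleftrightarrow> (\<phi> \<^bold>\<longrightarrow> Bel a (\<phi> \<^bold>\<and> Ann \<phi> \<psi>) (Ann \<phi> \<chi>)))"

end

theory Submission imports Defs begin

text \<open>The key to the modal axioms is that \<open>Know a \<phi>\<close>, although defined from belief, is the
  universal modality on the indistinguishability class: (sc) applied to the empty set puts
  \<open>X \<inter> cell M a w\<close> into \<open>nbh M a w X\<close> when it is non-empty, while (d) empties
  \<open>nbh M a w X\<close> otherwise. The reduction axiom for belief holds
  because the update keeps the neighbourhoods of sets of surviving worlds, and by (c) these
  neighbourhoods consist of surviving worlds.\<close>

abbreviation truth_set :: "('p, 'a, 'w) cn_struct \<Rightarrow> ('p, 'a) fm \<Rightarrow> 'w set" where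
  "truth_set M \<phi> \<equiv> {v \<in> worlds M. sat M v \<phi>}"

text \<open>Truth at a fixed world is one particular assignment to the non-Boolean subformulas; this
  yields (Taut).\<close>

lemma sat_eq_bool_eval: "sat M w \<phi> \<longleftrightarrow> bool_eval (sat M w) \<phi>"
  by (induction \<phi>) auto

lemma cell_subset_worlds: "cell M a w \<subseteq> worlds M"
  by (auto simp: cell_def)

lemma self_in_cell: "w \<in> worlds M \<Longrightarrow> w \<in> cell M a w"
  by (simp add: cell_def)

lemma nbh_cong_cell:
  "v \<in> cell M a w \<Longrightarrow> X \<subseteq> worlds M \<Longrightarrow> nbh M a v X = nbh M a w X"
  by (simp add: cell_def)

context
  fixes M :: "('p, 'a, 'w) cn_struct" and a :: 'a and w :: 'w and X :: "'w set"
  assumes model: "cn_model M" and w: "w \<in> worlds M" and X: "X \<subseteq> worlds M"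
begin

lemma nbh_subset: "Y \<in> nbh M a w X \<Longrightarrow> Y \<subseteq> X \<inter> cell M a w"
  using model w X unfolding cn_model_def by meson

lemma nbh_cong_inter:
  "Y \<subseteq> worlds M \<Longrightarrow> X \<inter> cell M a w = Y \<inter> cell M a w \<Longrightarrow> nbh M a w X = nbh M a w Y"
  using model w X unfolding cn_model_def by meson

lemma complement_notin_nbh: "Y \<in> nbh M a w X \<Longrightarrow> (X \<inter> cell M a w) - Y \<notin> nbh M a w X"
  using model w X unfolding cn_model_def by meson

lemma nbh_strong_commitment:
  assumes "Z \<subseteq> X \<inter> cell M a w" "(X \<inter> cell M a w) - Y \<notin> nbh M a w X" "Y \<subset> Z"
  shows "Z \<in> nbh M a w X"
proof -
  have "Y \<subseteq> X \<inter> cell M a w"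
    using assms by blast
  then show ?thesis
    using model w X assms unfolding cn_model_def by meson
qed

text \<open>By (d) the complement of a neighbourhood is not a neighbourhood, which is the premise
  that (sc) needs to admit every proper superset.\<close>

lemma nbh_mono:
  assumes "Y \<in> nbh M a w X" "Y \<subseteq> Z" "Z \<subseteq> X \<inter> cell M a w"
  shows "Z \<in> nbh M a w X"
  using assms complement_notin_nbh nbh_strong_commitment by (cases "Y = Z") auto

text \<open>If the two were disjoint, the complement of \<open>Y\<close> would include
  \<open>Z\<close>, hence be a neighbourhood by monotonicity, against (d).\<close>

lemma nbh_inter_nonempty:
  assumes "Y \<in> nbh M a w X" "Z \<in> nbh M a w X"
  shows "Y \<inter> Z \<noteq> {}"
proof
  assume "Y \<inter> Z = {}"
  then have "Z \<subseteq> (X \<inter> cell M a w) - Y"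
    using nbh_subset[OF assms(2)] by blast
  then have "(X \<inter> cell M a w) - Y \<in> nbh M a w X"
    using assms(2) nbh_mono by blast
  then show False
    using complement_notin_nbh[OF assms(1)] by blast
qed

lemma nbh_empty_iff: "nbh M a w X = {} \<longleftrightarrow> X \<inter> cell M a w = {}"
proof
  assume "nbh M a w X = {}"
  then show "X \<inter> cell M a w = {}"
    using nbh_strong_commitment[of "X \<inter> cell M a w" "{}"] by blast
next
  assume "X \<inter> cell M a w = {}"
  \<comment> \<open>By (c) a member could only be the empty set, which is disjoint from
    itself.\<close>
  then show "nbh M a w X = {}"
    using nbh_subset nbh_inter_nonempty by blast
qed

end

lemma sat_Know_iff:
  assumes "cn_model M" "w \<in> worlds M"
  shows "sat M w (Know a \<phi>) \<longleftrightarrow> (\<forall>v \<in> cell M a w. sat M v \<phi>)"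
proof -
  let ?X = "truth_set M (\<^bold>\<not> \<phi>)"
  \<comment> \<open>\<open>Top\<close> holds at all worlds, so by (c) it contains every
    neighbourhood: belief in \<open>Top\<close> just says that there is one.\<close>
  have "sat M w (Know a \<phi>) \<longleftrightarrow> nbh M a w ?X = {}"
    using nbh_subset[OF assms, of ?X] by fastforce
  also have "\<dots> \<longleftrightarrow> ?X \<inter> cell M a w = {}"
    by (rule nbh_empty_iff[OF assms]) blast
  also have "\<dots> \<longleftrightarrow> (\<forall>v \<in> cell M a w. sat M v \<phi>)"
    using cell_subset_worlds[of M a w] by auto
  finally show ?thesis .
qed

lemma sat_Poss_iff:
  assumes "cn_model M" "w \<in> worlds M"
  shows "sat M w (Poss a \<phi>) \<longleftrightarrow> (\<exists>v \<in> cell M a w. sat M v \<phi>)"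
  unfolding sat.simps(3)[of M w "Know a (\<^bold>\<not> \<phi>)"] sat_Know_iff[OF assms] by simp

text \<open>\<open>Know\<close> and \<open>Poss\<close> are negations themselves, so a general
  unfolding of \<open>sat.simps(3)\<close> would dissolve them. Rewriting implications with this
  equation keeps them intact for \<open>sat_Know_iff\<close> and
  \<open>sat_Poss_iff\<close>.\<close>

lemma sat_Imp: "sat M w (\<phi> \<^bold>\<longrightarrow> \<psi>) \<longleftrightarrow> (sat M w \<phi> \<longrightarrow> sat M w \<psi>)"
  by simp

lemma sat_Bel_cong_cell:
  "v \<in> cell M a w \<Longrightarrow> sat M v (Bel a \<phi> \<psi>) \<longleftrightarrow> sat M w (Bel a \<phi> \<psi>)"
  using nbh_cong_cell[of v M a w "truth_set M \<phi>"] by simp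

lemma sat_Bel_cong:
  assumes "cn_model M" "w \<in> worlds M" "\<forall>v \<in> cell M a w. sat M v \<phi> \<longleftrightarrow> sat M v \<psi>"
  shows "sat M w (Bel a \<phi> \<chi>) \<longleftrightarrow> sat M w (Bel a \<psi> \<chi>)"
proof -
  have "nbh M a w (truth_set M \<phi>) = nbh M a w (truth_set M \<psi>)"
    using assms by (intro nbh_cong_inter) auto
  then show ?thesis by simp
qed

text \<open>By (c) all relevant neighbourhoods lie within
  \<open>truth_set M \<chi> \<inter> cell M a w\<close>, so the implication is demanded only there.
  In this form the lemma serves both (M) and (C): on worlds satisfying \<phi>, \<psi> implies \<phi>
  \<and> \<psi>.\<close>

lemma sat_Bel_mono:
  assumes "cn_model M" "w \<in> worlds M" "sat M w (Bel a \<chi> \<phi>)"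
    and "\<forall>v \<in> truth_set M \<chi> \<inter> cell M a w. sat M v \<phi> \<longrightarrow> sat M v \<psi>"
  shows "sat M w (Bel a \<chi> \<psi>)"
proof -
  obtain Y where Y: "Y \<in> nbh M a w (truth_set M \<chi>)" "Y \<subseteq> truth_set M \<phi>"
    using assms(3) by auto
  then have "Y \<subseteq> truth_set M \<chi> \<inter> cell M a w"
    by (intro nbh_subset[OF assms(1,2)]) auto
  with Y(2) assms(4) have "Y \<subseteq> truth_set M \<psi>" by blast
  with Y(1) show ?thesis by auto
qed

lemma sat_Bel_consistent:
  assumes "cn_model M" "w \<in> worlds M" "sat M w (Bel a \<phi> \<psi>)"
  shows "\<not> sat M w (Bel a \<phi> (\<^bold>\<not> \<psi>))"
proof
  assume "sat M w (Bel a \<phi> (\<^bold>\<not> \<psi>))"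
  then obtain Y Z where
    "Y \<in> nbh M a w (truth_set M \<phi>)" "Y \<subseteq> truth_set M \<psi>"
    "Z \<in> nbh M a w (truth_set M \<phi>)" "Z \<subseteq> truth_set M (\<^bold>\<not> \<psi>)"
    using assms(3) by auto
  then show False
    using nbh_inter_nonempty[OF assms(1,2), of "truth_set M \<phi>" Y a Z] by auto
qed

lemma sat_Bel_strong_commitment:
  assumes "cn_model M" "w \<in> worlds M" "\<not> sat M w (Bel a \<chi> (\<^bold>\<not> \<phi>))"
    and v: "v \<in> cell M a w" "sat M v \<chi>" "\<not> sat M v \<phi>" "sat M v \<psi>"
  shows "sat M w (Bel a \<chi> (\<phi> \<^bold>\<or> \<psi>))"
proof -
  let ?X = "truth_set M \<chi> \<inter> cell M a w"
  \<comment> \<open>In (sc) the smaller set is the \<phi>-part of \<open>?X\<close>: its complement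
    consists of worlds refuting \<phi>, so it cannot be a neighbourhood. The world \<open>v\<close>
    makes the inclusion in \<open>?Z\<close> proper.\<close>
  let ?Y = "?X \<inter> truth_set M \<phi>"
  let ?Z = "?X \<inter> truth_set M (\<phi> \<^bold>\<or> \<psi>)"
  have "?X - ?Y \<subseteq> truth_set M (\<^bold>\<not> \<phi>)" by auto
  then have "?X - ?Y \<notin> nbh M a w (truth_set M \<chi>)"
    using assms(3) unfolding sat.simps(5) by blast
  moreover have "?Y \<subset> ?Z"
    using v cell_subset_worlds[of M a w] by auto
  ultimately have "?Z \<in> nbh M a w (truth_set M \<chi>)"
    by (intro nbh_strong_commitment[OF assms(1,2), of _ ?Z a ?Y]) auto
  then show ?thesis
    unfolding sat.simps(5) by (rule bexI[rotated]) blast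
qed

lemma sat_Ann_Bel:
  assumes "cn_model M" "w \<in> worlds M"
  shows "sat M w (Ann \<phi> (Bel a \<psi> \<chi>)) \<longleftrightarrow>
    (sat M w \<phi> \<longrightarrow> sat M w (Bel a (\<phi> \<^bold>\<and> Ann \<phi> \<psi>) (Ann \<phi> \<chi>)))"
proof -
  let ?U = "truth_set M \<phi>"
  let ?M = "restrict_model M ?U"
  let ?X = "truth_set M (\<phi> \<^bold>\<and> Ann \<phi> \<psi>)"
  have X: "truth_set ?M \<psi> = ?X"
    by (auto simp: restrict_model_def)
  \<comment> \<open>By (c) \<open>Y\<close> consists of \<phi>-worlds, where the guard of
    \<open>Ann \<phi> \<chi>\<close> is met and its truth is that of \<chi> after the
    update.\<close>
  have "Y \<subseteq> truth_set ?M \<chi> \<longleftrightarrow> Y \<subseteq> truth_set M (Ann \<phi> \<chi>)" if "Y \<in> nbh M a w ?X" for Y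
    using nbh_subset[OF assms _ that] by (auto simp: restrict_model_def)
  then have "sat ?M w (Bel a \<psi> \<chi>) \<longleftrightarrow> sat M w (Bel a (\<phi> \<^bold>\<and> Ann \<phi> \<psi>) (Ann \<phi> \<chi>))"
    unfolding sat.simps(5) X by (auto simp: restrict_model_def)
  then show ?thesis by simp
qed

theorem theorem6:
  fixes \<phi> :: "('p, 'a::finite) fm"
    and M :: "('p, 'a, 'w) cn_struct"
    and w :: 'w
  assumes "PC \<phi>" and "cn_model M" and "w \<in> worlds M"
  shows "sat M w \<phi>"
  using assms(1,3)
\<comment> \<open>\<open>NecK\<close> needs the induction hypothesis at every world of the cell, so
  \<open>w\<close> varies; \<open>M\<close> stays fixed because no rule passes to an updated
  model.\<close>
proof (induction arbitrary: w rule: PC.induct)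
  case (Taut \<phi>)
  then show ?case
    by (simp add: tautology_def sat_eq_bool_eval[of M w \<phi>])
next
  case (DistK a \<phi> \<psi>)
  then show ?case
    unfolding sat_Imp sat_Know_iff[OF assms(2) DistK] by blast
next
  case (T a \<phi>)
  show ?case
    unfolding sat_Imp sat_Know_iff[OF assms(2) T] using self_in_cell[OF T, of a] by blast
next
  case (B5 a \<phi> \<psi>)
  show ?case
    unfolding sat_Imp sat_Know_iff[OF assms(2) B5]
    using sat_Bel_cong_cell[of _ M a w \<phi> \<psi>] by blast
next
  case (B4 a \<phi> \<psi>)
  show ?case
    unfolding sat_Imp sat_Know_iff[OF assms(2) B4] unfolding sat.simps(3)
    using sat_Bel_cong_cell[of _ M a w \<phi> \<psi>] by blast
next
  case (D a \<phi> \<psi>)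
  show ?case
    unfolding sat_Imp sat.simps(3)[of _ _ "Bel _ _ _"]
    using sat_Bel_consistent[OF assms(2) D, of a \<phi> \<psi>] by blast
next
  case (EC a \<phi> \<psi> \<chi>)
  show ?case
    unfolding sat_Imp sat_Know_iff[OF assms(2) EC] sat.simps(4)
    using sat_Bel_cong[OF assms(2) EC, of a \<phi> \<psi> \<chi>] by blast
next
  case (M a \<phi> \<psi> \<chi>)
  show ?case
    unfolding sat_Imp sat_Know_iff[OF assms(2) M]
    using sat_Bel_mono[OF assms(2) M, of a \<chi> \<phi> \<psi>] by blast
next
  case (C a \<phi> \<psi>)
  show ?case
    unfolding sat_Imp
    using sat_Bel_mono[OF assms(2) C, of a \<phi> \<psi> "\<phi> \<^bold>\<and> \<psi>"] by simp
next
  case (SC a \<chi> \<phi> \<psi>)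
  show ?case
    unfolding sat_Imp sat.simps(4) sat_Poss_iff[OF assms(2) SC] unfolding sat.simps(3)
    using sat_Bel_strong_commitment[OF assms(2) SC, of a \<chi> \<phi> _ \<psi>] by blast
next
  case (MP \<phi> \<psi>)
  show ?case
    using MP.IH[OF MP.prems] unfolding sat_Imp by blast
next
  case (NecK \<phi> a)
  show ?case
    unfolding sat_Know_iff[OF assms(2) NecK.prems]
    using NecK.IH cell_subset_worlds[of M a w] by blast
next
  case (AnnAtom \<phi> p)
  then show ?case
    by (auto simp: restrict_model_def)
next
  case (AnnBel \<phi> a \<psi> \<chi>)
  show ?case
    unfolding sat.simps(4) sat_Imp
    using sat_Ann_Bel[OF assms(2) AnnBel, of \<phi> a \<psi> \<chi>] by blast
qed auto

end
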